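(* Let $(S,\sim,\cdot,|\ |)$ satisfy axioms A1–A13 (listed in the context), and let $\overrightarrow{S}$ be the set of vectors. The scalar product of vectors has the following properties, for all $\overrightarrow{a},\overrightarrow{b},\overrightarrow{c}\in\overrightarrow{S}$ and $\lambda\in\mathbb{R}$: 1. $\overrightarrow{a}\neq\overrightarrow{0}\Rightarrow\overrightarrow{a}\cdot\overrightarrow{a}>0$; 2. $(\overrightarrow{a}+\overrightarrow{b})\cdot\overrightarrow{c}=\overrightarrow{a}\cdot\overrightarrow{c}+\overrightarrow{b}\cdot\overrightarrow{c}$; 3. $(\lambda\overrightarrow{a})\cdot\overrightarrow{b}=\lambda(\overrightarrow{a}\cdot\overrightarrow{b})$; 4. $\overrightarrow{a}\cdot\overrightarrow{b}=\overrightarrow{b}\cdot\overrightarrow{a}$.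
   Context: $S$ is a non-empty set whose elements are called points. An ordered pair $(A,B)\in S^2$ is written $AB$ and called an arrow. The primitive notions are a binary relation $\sim$ on $S^2$, a multiplication $\cdot:\mathbb{R}\times S^2\to S^2$, $(\lambda,AB)\mapsto\lambda\cdot AB$ (also written $\lambda AB$), and a distance function $|\ |:S^2\to\mathbb{R}$, $AB\mapsto|AB|$. Addition of arrows: $AB+BC=AC$; more generally $AB+CD=AB+BX=AX$, where $X$ is a point with $BX\sim CD$, provided such a point exists (it is then unique by A2). Axioms (for all points and all real $\lambda,\mu$): A1: $\sim$ is an equivalence relation on $S^2$. A2: $AB\sim AC\Rightarrow B=C$. A3.1: $AB\sim A'B'\Rightarrow BA\sim B'A'$. A3.2: $AB\sim A'B'$ and $BC\sim B'C'$ imply $AC\sim A'C'$. A4: for all $\lambda,A,B$ there is $C$ with $\lambda\cdot AB=AC$. A5: $AB\sim CD\Rightarrow\lambda AB\sim\lambda CD$. A6.1: $1\cdot AB=AB$. A6.2: $\lambda\cdot AB+\mu\cdot AB=(\lambda+\mu)\cdot AB$ (in particular the left side is defined). A6.3: $\lambda\cdot(\mu\cdot AB)=(\lambda\mu)\cdot AB$. A7: if $AC=\lambda\cdot AB$ and $AC'=\lambda\cdot AB'$, then $CC'\sim\lambda\cdot BB'$. A8: $AB\sim CD\Rightarrow|AB|=|CD|$. A9.1: $|AA|=0$. A9.2: $B\neq A\Rightarrow|AB|>0$. A9.3: $|AB|=|BA|$. A10: $|\lambda AB|=\lambda|AB|$ for $\lambda>0$. A11: if a line has two (distinct) common points $A,B$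 with a circle, then the midpoint $P$ of $AB$ is the point on the line nearest to the center of the circle. A12: if a line has exactly one common point with a circle, then that common point is the point on the line nearest to the center of the circle. A13: $|AB|=|AC|\Rightarrow AB_{AC}=AC_{AB}$. Definitions used: For $A\ne B$, the line through $A,B$ is $p(A,B)=\{C: AC=\lambda\cdot AB\text{ for some }\lambda\in\mathbb{R}\}$. The midpoint of $AB$ is the point $P$ with $AP\sim PB$. The circle with center $S_0$ and radius $r>0$ is $\{T:|S_0T|=r\}$. A point $N$ of a line $p$ is the point on $p$ nearest to a point $Q$ if $|QN|<|QX|$ for every $X\in p$, $X\neq N$. The orthogonal projection of a point $Q$ to a line $p$ is the point on $p$ nearest to $Q$ (it exists by the axioms). For $C\neq D$, if $A',B'$ are the orthogonal projections of $A,B$ to $p(C,D)$, then $A'B'\sim\alpha\cdot CD$ for some real number $\alpha$, and the scalar orthogonal projection of $AB$ onto $CD$ is $AB_{CD}=\alpha|CD|$; for $C=D$, $AB_{CC}=0$. The scalar product of arrows is $AB\cdot CD=AB_{CD}\,|CD|$. Vectors: $\overrightarrow{AB}=\{CD : CD\sim AB\}$ is the $\sim$-class of $AB$, and $\overrightarrow{S}$ is the set of all these classes. $\overrightarrow{0}=\overrightarrow{AA}$; $\overrightarrow{AB}+\overrightarrow{BC}=\overrightarrow{AC}$ (any two vectors can be represented by arrows of the form $AB$, $BC$); $\lambda\cdot\overrightarrow{AB}=\overrightarrow{\lambda\cdot AB}$; scalar product of vectors: $\overrightarrow{AB}\cdot\overrightarrow{CD}=AB\cdot CD$. These definitions do not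 depend on the choice of representing arrows. *)

theory Defs
  imports Complex_Main
begin

type_synonym 'p arrow = "'p \<times> 'p"

(* The set of points is the type 'p, and (A, B) is the arrow AB. This first locale
   carries no assumptions: some of the axioms below are formulated with derived notions. *)
locale arrow_structure =
  fixes sim :: "'p arrow \<Rightarrow> 'p arrow \<Rightarrow> bool" (infix "\<sim>" 50)
    and smult :: "real \<Rightarrow> 'p arrow \<Rightarrow> 'p arrow" (infixr "\<odot>" 75)
    and len :: "'p arrow \<Rightarrow> real"
begin

(* Addition of arrows is partial: AB + CD is defined, with value AX, iff there is a point X
   with BX \<sim> CD. The predicate is_sum a b c says that a + b is defined and equal to c. *)
definition is_sum :: "'p arrow \<Rightarrow> 'p arrow \<Rightarrow> 'p arrow \<Rightarrow> bool" where
  "is_sum a b c \<longleftrightarrow> fst c = fst a \<and> (snd a, snd c) \<sim> b"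

definition line :: "'p \<Rightarrow> 'p \<Rightarrow> 'p set" where
  "line A B = {C. \<exists>t. (A, C) = t \<odot> (A, B)}"

definition is_line :: "'p set \<Rightarrow> bool" where
  "is_line l \<longleftrightarrow> (\<exists>A B. A \<noteq> B \<and> l = line A B)"

definition is_midpoint :: "'p \<Rightarrow> 'p \<Rightarrow> 'p \<Rightarrow> bool" where
  "is_midpoint P A B \<longleftrightarrow> (A, P) \<sim> (P, B)"

definition circle :: "'p \<Rightarrow> real \<Rightarrow> 'p set" where
  "circle Q r = {T. len (Q, T) = r}"

definition is_nearest :: "'p \<Rightarrow> 'p \<Rightarrow> 'p set \<Rightarrow> bool" where
  "is_nearest N Q l \<longleftrightarrow> N \<in> l \<and> (\<forall>X\<in>l. X \<noteq> N \<longrightarrow> len (Q, N) < len (Q, X))"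

definition orth_proj :: "'p \<Rightarrow> 'p set \<Rightarrow> 'p" where
  "orth_proj Q l = (THE N. is_nearest N Q l)"

definition scalar_proj :: "'p arrow \<Rightarrow> 'p arrow \<Rightarrow> real" where
  "scalar_proj a c =
    (if fst c = snd c then 0
     else (let l = line (fst c) (snd c)
           in (THE t. (orth_proj (fst a) l, orth_proj (snd a) l) \<sim> t \<odot> c) * len c))"

definition arrow_prod :: "'p arrow \<Rightarrow> 'p arrow \<Rightarrow> real" where
  "arrow_prod a c = scalar_proj a c * len c"

definition vec :: "'p arrow \<Rightarrow> 'p arrow set" where
  "vec a = {c. c \<sim> a}"

definition vectors :: "'p arrow set set" where
  "vectors = range vec"

(* The operations on vectors are defined through representatives; the axioms make the
   results independent of their choice, so that the definite descriptions denote. *)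

definition zero_vec :: "'p arrow set" where
  "zero_vec = (THE z. \<exists>A. z = vec (A, A))"

definition vec_add :: "'p arrow set \<Rightarrow> 'p arrow set \<Rightarrow> 'p arrow set" where
  "vec_add u v = (THE w. \<exists>A B C. u = vec (A, B) \<and> v = vec (B, C) \<and> w = vec (A, C))"

definition vec_smult :: "real \<Rightarrow> 'p arrow set \<Rightarrow> 'p arrow set" where
  "vec_smult t u = (THE w. \<exists>a. u = vec a \<and> w = vec (t \<odot> a))"

definition scalar_prod :: "'p arrow set \<Rightarrow> 'p arrow set \<Rightarrow> real" where
  "scalar_prod u v = (THE r. \<exists>a c. u = vec a \<and> v = vec c \<and> r = arrow_prod a c)"

end

locale arrow_space = arrow_structure +
  assumes A1: "equivp sim"
    and A2: "(A, B) \<sim> (A, C) \<Longrightarrow> B = C"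
    and A3_1: "(A, B) \<sim> (A', B') \<Longrightarrow> (B, A) \<sim> (B', A')"
    and A3_2: "(A, B) \<sim> (A', B') \<Longrightarrow> (B, C) \<sim> (B', C') \<Longrightarrow> (A, C) \<sim> (A', C')"
    and A4: "\<exists>C. t \<odot> (A, B) = (A, C)"
    and A5: "(A, B) \<sim> (C, D) \<Longrightarrow> t \<odot> (A, B) \<sim> t \<odot> (C, D)"
    and A6_1: "1 \<odot> (A, B) = (A, B)"
    and A6_2: "is_sum (s \<odot> (A, B)) (t \<odot> (A, B)) ((s + t) \<odot> (A, B))"
    and A6_3: "s \<odot> (t \<odot> (A, B)) = (s * t) \<odot> (A, B)"
    and A7: "(A, C) = t \<odot> (A, B) \<Longrightarrow> (A, C') = t \<odot> (A, B') \<Longrightarrow> (C, C') \<sim> t \<odot> (B, B')"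
    and A8: "(A, B) \<sim> (C, D) \<Longrightarrow> len (A, B) = len (C, D)"
    and A9_1: "len (A, A) = 0"
    and A9_2: "B \<noteq> A \<Longrightarrow> len (A, B) > 0"
    and A9_3: "len (A, B) = len (B, A)"
    and A10: "t > 0 \<Longrightarrow> len (t \<odot> (A, B)) = t * len (A, B)"
    and A11: "is_line l \<Longrightarrow> r > 0 \<Longrightarrow> A \<noteq> B \<Longrightarrow> A \<in> l \<inter> circle Q r \<Longrightarrow> B \<in> l \<inter> circle Q r
      \<Longrightarrow> is_midpoint P A B \<Longrightarrow> is_nearest P Q l"
    and A12: "is_line l \<Longrightarrow> r > 0 \<Longrightarrow> l \<inter> circle Q r = {N} \<Longrightarrow> is_nearest N Q l"
    and A13: "len (A, B) = len (A, C) \<Longrightarrow> scalar_proj (A, B) (A, C) = scalar_proj (A, C) (A, B)"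

end

theory Submission
  imports Defs "HOL-Analysis.Product_Vector"
begin

text \<open>
The axioms make the points an affine space, and the arrows issuing from a fixed point a real
vector space on which the length is a function \<open>N\<close> with \<open>N (t v) = \<bar>t\<bar> N v\<close>. The decisive
notion is the orthogonality
\<open>N (h + c) = N (h - c)\<close>: by A11 and A12, it says that the origin is the foot of the
perpendicular from \<open>h\<close> to the line spanned by \<open>c\<close>. It is visibly symmetric, and since the foot
is the midpoint of every chord that a circle around \<open>h\<close> cuts from the line, it is homogeneous.

Projecting both legs of a right triangle \<open>v = h + c\<close> onto its hypotenuse gives Pythagoras' theorem:
the coefficients of the two projections add up to \<open>1\<close>, and A13, extended to vectors of
different lengths by homogeneity, identifies them as \<open>(N h)\<^sup>2 / (N v)\<^sup>2\<close> and
\<open>(N c)\<^sup>2 / (N v)\<^sup>2\<close> (lemma \<open>pythagoras\<close>). Decomposing \<open>a\<close> into a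
multiple \<open>\<alpha> c\<close> and an orthogonal part then yields both the parallelogram law and the value
\<open>\<alpha> (N c)\<^sup>2\<close> of the polarization \<open>((N (a + c))\<^sup>2 - (N (a - c))\<^sup>2) / 4\<close>. By the argument of
Jordan and von Neumann the polarization is additive; its homogeneity for real scalars comes
directly from that of projections.

So the scalar product, which is a projection coefficient times a squared length, is the
polarization of the length (lemma \<open>arrow_prod_polar\<close>). In this form it depends only on
the classes of the two arrows, and the four properties can be read off.

The passage from arrows to vectors uses charts: affine maps from a real vector space into the
points. Any finite number of points lies in the image of a chart on some power of the reals
(lemma \<open>chart_extend\<close>), so identities between arrows reduce to identities in a vector space. A chart
need not be injective, for which reason \<open>N\<close> may vanish on non-zero vectors.
\<close>

section \<open>Seminorms with unique feet of perpendiculars\<close>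

text \<open>The function \<open>N\<close> is the length of arrows from a common initial point, pulled back along a
possibly non-injective affine map. Hence \<open>N\<close> may have null vectors, and \<open>N_null\<close> says
that these do not affect other lengths. The scalar
\<open>\<alpha>\<close> in the last three assumptions is the coefficient of the projection of \<open>a\<close> onto \<open>c\<close>; the last
one is A13.\<close>

locale foot_seminorm =
  fixes N :: "'v::real_vector \<Rightarrow> real"
  assumes N_scale: "N (t *\<^sub>R v) = \<bar>t\<bar> * N v"
    and N_nonneg: "0 \<le> N v"
    and N_null: "N c = 0 \<Longrightarrow> N (a + c) = N a"
    and foot_exists: "N c \<noteq> 0 \<Longrightarrow>
      \<exists>\<alpha>. \<forall>t. N (a - \<alpha> *\<^sub>R c + t *\<^sub>R c) = N (a - \<alpha> *\<^sub>R c - t *\<^sub>R c)"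
    and foot_unique: "N c \<noteq> 0 \<Longrightarrow> N (a - \<alpha> *\<^sub>R c + c) = N (a - \<alpha> *\<^sub>R c - c) \<Longrightarrow>
      N (a - \<beta> *\<^sub>R c + c) = N (a - \<beta> *\<^sub>R c - c) \<Longrightarrow> \<alpha> = \<beta>"
    and foot_symmetric: "N a = N c \<Longrightarrow> N c \<noteq> 0 \<Longrightarrow>
      N (a - \<alpha> *\<^sub>R c + c) = N (a - \<alpha> *\<^sub>R c - c) \<Longrightarrow>
      N (c - \<beta> *\<^sub>R a + a) = N (c - \<beta> *\<^sub>R a - a) \<Longrightarrow> \<alpha> = \<beta>"
begin

definition orth :: "'v \<Rightarrow> 'v \<Rightarrow> bool" where
  "orth h c \<longleftrightarrow> N (h + c) = N (h - c)"

definition polar :: "'v \<Rightarrow> 'v \<Rightarrow> real" where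
  "polar u v = ((N (u + v))\<^sup>2 - (N (u - v))\<^sup>2) / 4"

lemma N_minus: "N (- v) = N v"
  using N_scale[of "-1" v] by simp

lemma N_zero: "N 0 = 0"
  using N_scale[of 0 0] by simp

lemma N_diff_commute: "N (u - v) = N (v - u)"
  using N_minus[of "u - v"] by simp

lemma N_null_diff: "N c = 0 \<Longrightarrow> N (a - c) = N a"
  using N_null[of "- c" a] by (simp add: N_minus)

lemma orth_sym: "orth h c \<Longrightarrow> orth c h"
  by (simp add: orth_def N_diff_commute[of c h] add.commute)

lemma orth_null: "N c = 0 \<Longrightarrow> orth h c"
  by (simp add: orth_def N_null N_null_diff)

lemma orth_minus: "orth h c \<Longrightarrow> orth (- h) c"
  using N_minus[of "h + c"] N_minus[of "h - c"] by (simp add: orth_def)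

text \<open>The foot of the perpendicular bisects the chords of all circles around \<open>h\<close> simultaneously, so
orthogonality to \<open>c\<close> passes to every multiple of \<open>c\<close>.\<close>

lemma orth_scale_right:
  assumes "orth h c" shows "orth h (t *\<^sub>R c)"
proof (cases "N c = 0")
  case True
  then show ?thesis by (simp add: orth_null N_scale)
next
  case False
  then obtain \<alpha> where \<alpha>: "\<And>t. orth (h - \<alpha> *\<^sub>R c) (t *\<^sub>R c)"
    using foot_exists unfolding orth_def by blast
  have "\<alpha> = 0"
    using foot_unique[of c h \<alpha> 0] False assms \<alpha>[of 1] by (simp add: orth_def)
  then show ?thesis using \<alpha>[of t] by simp
qed

lemma orth_scale: "orth h c \<Longrightarrow> orth (s *\<^sub>R h) (t *\<^sub>R c)"
  by (rule orth_scale_right, rule orth_sym, rule orth_scale_right, rule orth_sym)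

lemma orth_decomposition:
  obtains \<alpha> h where "a = h + \<alpha> *\<^sub>R c" "orth h c"
proof (cases "N c = 0")
  case True
  then show ?thesis using that[of a 0] by (simp add: orth_null)
next
  case False
  then obtain \<alpha> where "\<forall>t. orth (a - \<alpha> *\<^sub>R c) (t *\<^sub>R c)"
    using foot_exists unfolding orth_def by blast
  then have "orth (a - \<alpha> *\<^sub>R c) (1 *\<^sub>R c)" by blast
  then show ?thesis using that[of "a - \<alpha> *\<^sub>R c" \<alpha>] by simp
qed

text \<open>A13 compares two projections only between vectors of equal length. Rescaling \<open>a\<close> to the length of
\<open>c\<close> multiplies the first coefficient by the ratio of the lengths and divides the second one by it.\<close>

lemma foot_symmetric_scaled:
  assumes a: "N a \<noteq> 0" and c: "N c \<noteq> 0"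
    and \<alpha>: "orth (a - \<alpha> *\<^sub>R c) c" and \<beta>: "orth (c - \<beta> *\<^sub>R a) a"
  shows "\<alpha> * (N c)\<^sup>2 = \<beta> * (N a)\<^sup>2"
proof -
  define k where "k = N c / N a"
  have k: "k \<noteq> 0" using a c by (simp add: k_def)
  have "N (k *\<^sub>R a) = N c" using a N_nonneg by (simp add: N_scale k_def)
  moreover have "orth (k *\<^sub>R a - (k * \<alpha>) *\<^sub>R c) c"
    using orth_scale[OF \<alpha>, of k 1] by (simp add: algebra_simps)
  moreover have "orth (c - (\<beta> / k) *\<^sub>R (k *\<^sub>R a)) (k *\<^sub>R a)"
    using orth_scale[OF \<beta>, of 1 k] k by simp
  ultimately have "k * \<alpha> = \<beta> / k"
    using foot_symmetric[of "k *\<^sub>R a" c "k * \<alpha>" "\<beta> / k"] c by (simp add: orth_def)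
  then have "\<alpha> * k\<^sup>2 = \<beta>" using k by (simp add: field_simps power2_eq_square)
  moreover have "N c = k * N a" using a by (simp add: k_def)
  ultimately show ?thesis by (simp add: power_mult_distrib)
qed

text \<open>Both legs project onto the hypotenuse \<open>v\<close> with coefficients that add up to \<open>1\<close>. Conversely \<open>v\<close>
projects onto each leg with coefficient \<open>1\<close>, so the symmetry of projections evaluates the
coefficients.\<close>

lemma pythagoras:
  assumes "orth h c" shows "(N (h + c))\<^sup>2 = (N h)\<^sup>2 + (N c)\<^sup>2"
proof (cases "N h = 0 \<or> N c = 0")
  case True
  then show ?thesis using N_null[of c h] N_null[of h c] by (auto simp: add.commute)
next
  case False
  define v where "v = h + c"
  have v: "N v \<noteq> 0"
  proof
    assume "N v = 0"
    moreover have "N (h - c) = N v" using assms by (simp add: orth_def v_def)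
    ultimately have "N (h - c + v) = 0" using N_null[of v "h - c"] by simp
    moreover have "h - c + v = 2 *\<^sub>R h" by (simp add: v_def scaleR_2)
    ultimately show False using False by (simp add: N_scale)
  qed
  obtain \<beta> k where \<beta>: "c = k + \<beta> *\<^sub>R v" "orth k v"
    by (rule orth_decomposition[of c v])
  have "orth (c - \<beta> *\<^sub>R v) v" using \<beta> by simp
  moreover have "orth (v - 1 *\<^sub>R c) c" using assms by (simp add: v_def)
  ultimately have c: "1 * (N c)\<^sup>2 = \<beta> * (N v)\<^sup>2"
    using foot_symmetric_scaled[OF v] False by metis
  \<comment> \<open>Since \<open>h = v - c\<close>, the part of \<open>h\<close> orthogonal to \<open>v\<close> is the negative of that of \<open>c\<close>.\<close>
  have "h - (1 - \<beta>) *\<^sub>R v = - k"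
    using \<beta>(1) by (simp add: v_def algebra_simps)
  then have "orth (h - (1 - \<beta>) *\<^sub>R v) v"
    using orth_minus[OF \<beta>(2)] by simp
  moreover have "orth (v - 1 *\<^sub>R h) h" using orth_sym[OF assms] by (simp add: v_def)
  ultimately have "1 * (N h)\<^sup>2 = (1 - \<beta>) * (N v)\<^sup>2"
    using foot_symmetric_scaled[OF v] False by metis
  then show ?thesis using c by (simp add: left_diff_distrib flip: v_def)
qed

lemma pythagoras_scale:
  assumes "orth h c" shows "(N (h + t *\<^sub>R c))\<^sup>2 = (N h)\<^sup>2 + t\<^sup>2 * (N c)\<^sup>2"
  using pythagoras[OF orth_scale_right[OF assms]] by (simp add: N_scale power_mult_distrib)

text \<open>In the plane of \<open>a\<close> and \<open>c\<close>, Pythagoras' theorem expresses all four lengths by the length of \<open>c\<close>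
and the two components of \<open>a\<close> along and across \<open>c\<close>.\<close>

lemma parallelogram: "(N (a + c))\<^sup>2 + (N (a - c))\<^sup>2 = 2 * (N a)\<^sup>2 + 2 * (N c)\<^sup>2"
proof -
  obtain \<alpha> h where a: "a = h + \<alpha> *\<^sub>R c" and h: "orth h c"
    by (rule orth_decomposition)
  have e: "a + c = h + (\<alpha> + 1) *\<^sub>R c" "a - c = h + (\<alpha> - 1) *\<^sub>R c"
    by (simp_all add: a algebra_simps)
  show ?thesis
    unfolding e unfolding a pythagoras_scale[OF h] by (simp add: power2_eq_square algebra_simps)
qed

text \<open>The common orthogonal part cancels in the difference of the squares of \<open>N (a + c)\<close> and
\<open>N (a - c)\<close>. This links the scalar product, defined by projection, to the polarization.\<close>

lemma polar_foot:
  assumes "orth (a - \<alpha> *\<^sub>R c) c" shows "polar a c = \<alpha> * (N c)\<^sup>2"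
proof -
  have "a + c = (a - \<alpha> *\<^sub>R c) + (\<alpha> + 1) *\<^sub>R c" "a - c = (a - \<alpha> *\<^sub>R c) + (\<alpha> - 1) *\<^sub>R c"
    by (simp_all add: algebra_simps)
  then show ?thesis
    using pythagoras_scale[OF assms, of "\<alpha> + 1"] pythagoras_scale[OF assms, of "\<alpha> - 1"]
    by (simp add: polar_def power2_eq_square algebra_simps)
qed

lemma polar_commute: "polar u v = polar v u"
  by (simp add: polar_def N_diff_commute[of u v] add.commute)

lemma polar_self: "polar u u = (N u)\<^sup>2"
  using N_scale[of 2 u] by (simp add: polar_def N_zero scaleR_2 power_mult_distrib)

lemma polar_scale: "polar (t *\<^sub>R a) c = t * polar a c"
proof -
  obtain \<alpha> h where a: "a = h + \<alpha> *\<^sub>R c" and h: "orth h c"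
    by (rule orth_decomposition)
  have "orth (a - \<alpha> *\<^sub>R c) c" "orth (t *\<^sub>R a - (t * \<alpha>) *\<^sub>R c) c"
    using h orth_scale[OF h, of t 1] by (simp_all add: a algebra_simps)
  then show ?thesis by (simp add: polar_foot)
qed

text \<open>The parallelogram laws for \<open>a + c, b + c\<close> and for \<open>a - c, b - c\<close> share the term in \<open>a - b\<close>;
their difference expresses the right-hand side by the polarization of \<open>a + b\<close> and \<open>2 c\<close>, from
which homogeneity removes the factor.\<close>

lemma polar_add: "polar (a + b) c = polar a c + polar b c"
proof -
  have e: "(a + c) + (b + c) = (a + b) + 2 *\<^sub>R c" "(a + c) - (b + c) = a - b"
    "(a - c) + (b - c) = (a + b) - 2 *\<^sub>R c" "(a - c) - (b - c) = a - b"
    by (simp_all add: algebra_simps scaleR_2)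
  have "polar (a + b) (2 *\<^sub>R c) = 2 * polar (a + b) c"
    by (metis polar_commute polar_scale)
  then show ?thesis
    using parallelogram[of "a + c" "b + c"] parallelogram[of "a - c" "b - c"]
    unfolding e by (simp add: polar_def field_simps)
qed

lemma polar_diff: "polar (b - a) c = polar b c - polar a c"
  using polar_add[of "b - a" a c] by simp

end

section \<open>The affine structure of the point set\<close>

context arrow_space
begin

lemma sim_refl [simp]: "a \<sim> a"
  using A1 by (rule equivp_reflp)

lemma sim_sym: "a \<sim> b \<Longrightarrow> b \<sim> a"
  using A1 by (rule equivp_symp)

lemma sim_trans [trans]: "a \<sim> b \<Longrightarrow> b \<sim> c \<Longrightarrow> a \<sim> c"
  using A1 by (rule equivp_transp)

lemma smult_eq: "t \<odot> (A, B) = (A, snd (t \<odot> (A, B)))"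
  using A4[of t A B] by auto

lemma smult_zero: "0 \<odot> (A, B) = (A, A)"
proof -
  obtain X where X: "0 \<odot> (A, B) = (A, X)" using A4 by blast
  have "(X, X) \<sim> (A, X)" using A6_2[of 0 A B 0] by (simp add: X is_sum_def)
  then have "(X, X) \<sim> (X, A)" by (rule A3_1)
  then show ?thesis using A2 X by blast
qed

lemma smult_minus_one: "(-1) \<odot> (A, B) \<sim> (B, A)"
  using A6_2[of 1 A B "-1"] by (simp add: A6_1 smult_zero is_sum_def sim_sym)

lemma midpoint_exists: "\<exists>P. (A, P) = (1/2) \<odot> (A, B) \<and> is_midpoint P A B"
proof -
  obtain P where P: "(1/2) \<odot> (A, B) = (A, P)" using A4 by blast
  then show ?thesis
    using A6_2[of "1/2" A B "1/2"]
    by (intro exI[of _ P]) (simp add: A6_1 is_sum_def is_midpoint_def sim_sym)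
qed

text \<open>The point reflection in the midpoint of a diagonal completes any three points to a parallelogram.
By A7 it reverses both pairs of opposite sides, which proves at once that arrows can be attached
to any point and, in the next lemma, that addition of vectors is commutative.\<close>

lemma fourth_vertex: "\<exists>X. (B, X) \<sim> (C, D) \<and> (B, C) \<sim> (X, D)"
proof -
  obtain M where "is_midpoint M B D" using midpoint_exists by blast
  then have M: "(B, M) \<sim> (M, D)" by (simp add: is_midpoint_def)
  \<comment> \<open>Multiplication by -1 at \<open>M\<close> is the point reflection in \<open>M\<close>.\<close>
  have refl: "(-1) \<odot> (M, P) = (M, Q)" if "(P, M) \<sim> (M, Q)" for P Q
    using smult_minus_one[of M P] that smult_eq[of "-1" M P]
    by (metis A2 sim_trans)
  have D: "(M, D) = (-1) \<odot> (M, B)" using refl[OF M] by simp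
  have B: "(M, B) = (-1) \<odot> (M, D)" using refl[OF sim_sym[OF A3_1[OF M]]] by simp
  obtain X where X: "(M, X) = (-1) \<odot> (M, C)" using A4 by metis
  have "(X, B) \<sim> (D, C)"
    using A7[OF X B] smult_minus_one sim_trans by blast
  moreover have "(X, D) \<sim> (B, C)"
    using A7[OF X D] smult_minus_one sim_trans by blast
  ultimately show ?thesis using A3_1 sim_sym by blast
qed

lemma parallelogram_swap:
  assumes "(A, B) \<sim> (C, D)" shows "(A, C) \<sim> (B, D)"
proof -
  obtain X where X: "(A, X) \<sim> (C, D)" "(A, C) \<sim> (X, D)"
    using fourth_vertex by blast
  then have "X = B" using assms A2 sim_sym sim_trans by blast
  then show ?thesis using X by simp
qed

lemma degenerate_sim: "(A, A) \<sim> (B, B)"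
  by (rule parallelogram_swap) simp

definition translate :: "'a arrow \<Rightarrow> 'a \<Rightarrow> 'a" where
  "translate p A = (THE X. (A, X) \<sim> p)"

lemma translate_eq: "(A, X) \<sim> p \<Longrightarrow> translate p A = X"
  unfolding translate_def using A2 sim_sym sim_trans by (metis (no_types, lifting) the_equality)

lemma translate_sim: "(A, translate p A) \<sim> p"
proof -
  obtain X where "(A, X) \<sim> p" using fourth_vertex[of A "fst p" "snd p"] by auto
  then show ?thesis by (simp add: translate_eq)
qed

lemma translate_smult_add:
  "translate (t \<odot> (O', P)) (translate (s \<odot> (O', P)) A) = translate ((s + t) \<odot> (O', P)) A"
proof -
  obtain S T where S: "s \<odot> (O', P) = (O', S)" and T: "(s + t) \<odot> (O', P) = (O', T)"
    using A4 by metis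
  have ST: "(S, T) \<sim> t \<odot> (O', P)"
    using A6_2[of s O' P t] by (simp add: S T is_sum_def)
  let ?B = "translate (s \<odot> (O', P)) A"
  have "(A, ?B) \<sim> (O', S)" using translate_sim[of A "s \<odot> (O', P)"] by (simp add: S)
  moreover have "(?B, translate (t \<odot> (O', P)) ?B) \<sim> (S, T)"
    using translate_sim ST sim_sym sim_trans by blast
  ultimately have "(A, translate (t \<odot> (O', P)) ?B) \<sim> (O', T)" by (rule A3_2)
  then show ?thesis using translate_eq T by metis
qed

lemma translate_sim_translate: "(translate p A, translate p B) \<sim> (A, B)"
  by (meson parallelogram_swap sim_sym sim_trans translate_sim)

text \<open>A chart need not be injective: the points it has to reach may be in special position, and a
case distinction by the dimension of their span is thereby avoided.\<close>

definition chart :: "('v::real_vector \<Rightarrow> 'a) \<Rightarrow> bool" where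
  "chart L \<longleftrightarrow>
    (\<forall>u v u' v'. v - u = v' - u' \<longrightarrow> (L u, L v) \<sim> (L u', L v')) \<and>
    (\<forall>u v t. t \<odot> (L u, L v) = (L u, L (u + t *\<^sub>R (v - u))))"

lemma chart_const: "chart (\<lambda>_. Q)"
proof -
  have "t \<odot> (Q, Q) = (Q, Q)" for t
    using A6_3[of t 0 Q Q] by (simp add: smult_zero)
  then show ?thesis by (simp add: chart_def)
qed

text \<open>The additional coordinate \<open>t\<close> moves the image by \<open>t\<close> times the arrow from the origin to \<open>P\<close>. The
second distributive law of scalar multiplication, which is A7, makes this affine.\<close>

lemma chart_extend:
  fixes L :: "'v::real_vector \<Rightarrow> 'a"
  assumes "chart L"
  shows "\<exists>L' :: 'v \<times> real \<Rightarrow> 'a. chart L' \<and> (\<forall>v. L' (v, 0) = L v) \<and> L' (0, 1) = P"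
proof -
  define p where "p = (L 0, P)"
  define L' where "L' = (\<lambda>(v, t). translate (t \<odot> p) (L v))"
  have tr: "translate (t \<odot> p) (translate (s \<odot> p) A) = translate ((s + t) \<odot> p) A" for s t A
    unfolding p_def by (rule translate_smult_add)
  have L_sim: "(L u, L v) \<sim> (L u', L v')" if "v - u = v' - u'" for u v u' v'
    using assms that by (simp add: chart_def)
  have diff: "(L' (u, s), L' (v, t)) \<sim> (L u, translate ((t - s) \<odot> p) (L v))" for u v s t
    using translate_sim_translate[of "s \<odot> p" "L u" "translate ((t - s) \<odot> p) (L v)"]
    by (simp add: L'_def tr)
  have L'_sim: "(L' x, L' y) \<sim> (L' x', L' y')" if "y - x = y' - x'" for x y x' y'
  proof -
    obtain u s v t u' s' v' t' where
      e: "x = (u, s)" "y = (v, t)" "x' = (u', s')" "y' = (v', t')"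
      by fastforce
    have d: "v - u = v' - u'" "t - s = t' - s'" using that by (auto simp: e)
    have "(L v, translate ((t - s) \<odot> p) (L v)) \<sim> (L v', translate ((t - s) \<odot> p) (L v'))"
      using translate_sim sim_sym sim_trans by blast
    from A3_2[OF L_sim[OF d(1)] this]
    show ?thesis unfolding e using diff d(2) sim_sym sim_trans by metis
  qed
  have "r \<odot> (L' x, L' y) = (L' x, L' (x + r *\<^sub>R (y - x)))" for r x y
  proof -
    obtain u s v t where e: "x = (u, s)" "y = (v, t)" by fastforce
    define d where "d = t - s"
    obtain C where C: "r \<odot> (L u, translate (d \<odot> p) (L v)) = (L u, C)" using A4 by blast
    have B: "r \<odot> (L u, L v) = (L u, L (u + r *\<^sub>R (v - u)))"
      using assms by (simp add: chart_def)
    have "(L (u + r *\<^sub>R (v - u)), C) \<sim> r \<odot> (L v, translate (d \<odot> p) (L v))"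
      using A7[OF B[symmetric] C[symmetric]] .
    also have "\<dots> \<sim> r \<odot> (d \<odot> p)"
      using A5 translate_sim by (metis surj_pair)
    also have "r \<odot> (d \<odot> p) = (r * d) \<odot> p" by (simp add: p_def A6_3)
    finally have C': "C = translate ((r * d) \<odot> p) (L (u + r *\<^sub>R (v - u)))"
      using translate_eq by simp
    have "r \<odot> (L' x, L' y) \<sim> r \<odot> (L u, translate (d \<odot> p) (L v))"
      using A5 diff by (simp add: e d_def)
    also have "\<dots> \<sim> (L' x, L' (x + r *\<^sub>R (y - x)))"
      using diff[of u s "u + r *\<^sub>R (v - u)" "s + r * (t - s)"]
      by (simp add: C[unfolded d_def] C' e d_def sim_sym)
    finally show ?thesis using smult_eq[of r "L' x" "L' y"] A2 by metis
  qed
  then have "chart L'" using L'_sim by (auto simp: chart_def)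
  moreover have "L' (v, 0) = L v" for v
    using translate_eq[of "L v" "L v" "0 \<odot> p"] degenerate_sim
    by (simp add: L'_def p_def smult_zero)
  moreover have "L' (0, 1) = P"
    by (simp add: L'_def p_def A6_1 translate_eq)
  ultimately show ?thesis by blast
qed

text \<open>Starting from the constant chart on the reals, one coordinate is added for each of the points
\<open>A\<close>, \<open>B\<close> and \<open>C\<close>.\<close>

lemma chart_exists:
  "\<exists>L :: ((real \<times> real) \<times> real) \<times> real \<Rightarrow> 'a. \<exists>a b c. chart L \<and>
    L 0 = Q \<and> L a = A \<and> L b = B \<and> L c = C"
proof -
  have const: "chart (\<lambda>_ :: real. Q)" by (rule chart_const)
  obtain L1 :: "real \<times> real \<Rightarrow> 'a" where
    L1: "chart L1" "\<And>v :: real. L1 (v, 0) = Q" "L1 (0, 1) = A"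
    using chart_extend[OF const, of A] by blast
  obtain L2 :: "(real \<times> real) \<times> real \<Rightarrow> 'a" where
    L2: "chart L2" "\<And>v. L2 (v, 0) = L1 v" "L2 (0, 1) = B"
    using chart_extend[OF L1(1), of B] by blast
  obtain L3 :: "((real \<times> real) \<times> real) \<times> real \<Rightarrow> 'a" where
    L3: "chart L3" "\<And>v. L3 (v, 0) = L2 v" "L3 (0, 1) = C"
    using chart_extend[OF L2(1), of C] by blast
  have "L3 0 = Q" by (simp add: zero_prod_def L1 L2 L3)
  moreover have "L3 (((0, 1), 0), 0) = A" "L3 ((0, 1), 0) = B" by (simp_all add: L1 L2 L3)
  ultimately show ?thesis using L3 by blast
qed

section \<open>Feet of perpendiculars\<close>

lemma nearest_unique: "is_nearest M Q l \<Longrightarrow> is_nearest N Q l \<Longrightarrow> M = N"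
  unfolding is_nearest_def by (metis less_asym)

lemma orth_proj_eq: "is_nearest N Q l \<Longrightarrow> orth_proj Q l = N"
  unfolding orth_proj_def using nearest_unique by blast

lemma len_eq_0_iff: "len (A, B) = 0 \<longleftrightarrow> A = B"
  using A9_1 A9_2 by (metis less_irrefl)

text \<open>A circle around \<open>Q\<close> through a point of the line meets the line once, which is the case of A12, or
in a further point, which is the case of A11.\<close>

lemma nearest_exists:
  assumes l: "is_line l" shows "\<exists>N. is_nearest N Q l"
proof -
  obtain A B where AB: "A \<noteq> B" "l = line A B" using l by (auto simp: is_line_def)
  have "A \<in> l" "B \<in> l"
    using smult_zero[of A B, symmetric] A6_1[of A B, symmetric] unfolding AB line_def by blast+
  \<comment> \<open>The radius has to be positive, and one of two distinct points of the line differs from \<open>Q\<close>.\<close>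
  then obtain X where X: "X \<in> l" "X \<noteq> Q" using AB(1) by blast
  define r where "r = len (Q, X)"
  have r: "r > 0" using X by (simp add: r_def A9_2)
  have Xr: "X \<in> l \<inter> circle Q r" using X by (simp add: circle_def r_def)
  show ?thesis
  proof (cases "l \<inter> circle Q r = {X}")
    case True
    then show ?thesis using A12[OF l r] by blast
  next
    case False
    then obtain Y where "Y \<in> l \<inter> circle Q r" "Y \<noteq> X" using Xr by blast
    moreover obtain P where "is_midpoint P X Y" using midpoint_exists by blast
    ultimately show ?thesis using A11[OF l r] Xr by metis
  qed
qed

end

locale arrow_chart = arrow_space sim smult len
  for sim :: "'a arrow \<Rightarrow> 'a arrow \<Rightarrow> bool" (infix "\<sim>" 50)
    and smult :: "real \<Rightarrow> 'a arrow \<Rightarrow> 'a arrow" (infixr "\<odot>" 75)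
    and len :: "'a arrow \<Rightarrow> real" +
  fixes L :: "'v::real_vector \<Rightarrow> 'a"
  assumes chart_L: "chart L"
begin

abbreviation chart_norm :: "'v \<Rightarrow> real" where
  "chart_norm v \<equiv> len (L 0, L v)"

lemma L_sim: "v - u = v' - u' \<Longrightarrow> (L u, L v) \<sim> (L u', L v')"
  using chart_L by (simp add: chart_def)

lemma L_smult: "t \<odot> (L u, L v) = (L u, L (u + t *\<^sub>R (v - u)))"
  using chart_L by (simp add: chart_def)

lemma len_L: "len (L u, L v) = chart_norm (v - u)"
  by (rule A8[OF L_sim]) simp

lemma L_eq_iff: "L u = L v \<longleftrightarrow> chart_norm (v - u) = 0"
  using len_L len_eq_0_iff by metis

lemma chart_norm_nonneg: "0 \<le> chart_norm v"
  using A9_1 A9_2 by (metis less_eq_real_def)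

lemma chart_norm_minus: "chart_norm (- v) = chart_norm v"
  using len_L[of v 0] A9_3 by simp

lemma chart_norm_scale: "chart_norm (t *\<^sub>R v) = \<bar>t\<bar> * chart_norm v"
proof -
  have pos: "chart_norm (s *\<^sub>R v) = s * chart_norm v" if "s > 0" for s
    using A10[OF that, of "L 0" "L v"] L_smult[of s 0 v] by simp
  consider "t > 0" | "t = 0" | "t < 0" by linarith
  then show ?thesis
  proof cases
    case 1
    then show ?thesis using pos by simp
  next
    case 2
    then show ?thesis by (simp add: A9_1)
  next
    case 3
    then show ?thesis using pos[of "- t"] chart_norm_minus[of "t *\<^sub>R v"] by simp
  qed
qed

lemma chart_norm_null: "chart_norm c = 0 \<Longrightarrow> chart_norm (a + c) = chart_norm a"
  using L_eq_iff[of a "a + c"] by simp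

lemma len_L': "len (L u, L v) = chart_norm (u - v)"
  using chart_norm_minus[of "v - u"] len_L[of u v] by simp

lemma L_axis_inj:
  assumes "chart_norm c \<noteq> 0" shows "L (s *\<^sub>R c) = L (t *\<^sub>R c) \<longleftrightarrow> s = t"
proof -
  have "t *\<^sub>R c - s *\<^sub>R c = (t - s) *\<^sub>R c" by (simp add: scaleR_left_diff_distrib)
  then show ?thesis using assms unfolding L_eq_iff by (auto simp: chart_norm_scale)
qed

lemma axis_iff: "X \<in> line (L 0) (L c) \<longleftrightarrow> (\<exists>s. X = L (s *\<^sub>R c))"
  by (auto simp: line_def L_smult)

lemma is_line_axis: "chart_norm c \<noteq> 0 \<Longrightarrow> is_line (line (L 0) (L c))"
  unfolding is_line_def using A9_1 by metis

lemma is_midpoint_L: "is_midpoint (L p) (L (p + d)) (L (p - d))"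
  unfolding is_midpoint_def by (rule L_sim) simp

text \<open>The points \<open>\<alpha> c + c\<close> and \<open>\<alpha> c - c\<close> of the line lie on a circle around \<open>a\<close>, so A11 applies to
their midpoint \<open>\<alpha> c\<close>.\<close>

lemma nearest_if_orth:
  assumes c: "chart_norm c \<noteq> 0"
    and orth: "chart_norm (a - \<alpha> *\<^sub>R c + c) = chart_norm (a - \<alpha> *\<^sub>R c - c)"
  shows "is_nearest (L (\<alpha> *\<^sub>R c)) (L a) (line (L 0) (L c))"
proof -
  let ?p = "\<alpha> *\<^sub>R c"
  let ?r = "chart_norm (a - ?p + c)"
  have d: "len (L a, L (?p + c)) = ?r" "len (L a, L (?p - c)) = ?r"
    using orth len_L'[of a "?p + c"] len_L'[of a "?p - c"] by (simp_all add: algebra_simps)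
  have ne: "L (?p + c) \<noteq> L (?p - c)"
  proof -
    have e: "(?p - c) - (?p + c) = (-2) *\<^sub>R c" by (simp add: scaleR_2)
    have "chart_norm ((-2) *\<^sub>R c) \<noteq> 0" using c unfolding chart_norm_scale by simp
    then show ?thesis unfolding L_eq_iff e .
  qed
  have "?r \<noteq> 0" using d ne len_eq_0_iff by metis
  then have r: "?r > 0" using chart_norm_nonneg[of "a - ?p + c"] by simp
  have "?p + c = (\<alpha> + 1) *\<^sub>R c" "?p - c = (\<alpha> - 1) *\<^sub>R c"
    by (simp_all add: algebra_simps)
  then have "L (?p + c) \<in> line (L 0) (L c) \<inter> circle (L a) ?r"
    "L (?p - c) \<in> line (L 0) (L c) \<inter> circle (L a) ?r"
    using d unfolding circle_def by (auto simp: axis_iff)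
  from A11[OF is_line_axis[OF c] r ne this is_midpoint_L] show ?thesis .
qed

lemma chart_foot_unique:
  assumes c: "chart_norm c \<noteq> 0"
    and "chart_norm (a - \<alpha> *\<^sub>R c + c) = chart_norm (a - \<alpha> *\<^sub>R c - c)"
    and "chart_norm (a - \<beta> *\<^sub>R c + c) = chart_norm (a - \<beta> *\<^sub>R c - c)"
  shows "\<alpha> = \<beta>"
proof -
  have "L (\<alpha> *\<^sub>R c) = L (\<beta> *\<^sub>R c)"
    using assms nearest_if_orth nearest_unique by metis
  then show ?thesis by (simp only: L_axis_inj[OF c])
qed

text \<open>The foot is the midpoint of every chord: a circle around \<open>a\<close> through a point of the line other
than the foot \<open>M\<close> cannot meet the line only there, because A12 would make that point nearest as
well; so it meets the line in a second point, and by A11 the midpoint of the two is \<open>M\<close>.\<close>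

lemma chart_foot_exists:
  assumes c: "chart_norm c \<noteq> 0"
  shows "\<exists>\<alpha>. \<forall>t. chart_norm (a - \<alpha> *\<^sub>R c + t *\<^sub>R c) = chart_norm (a - \<alpha> *\<^sub>R c - t *\<^sub>R c)"
proof -
  let ?l = "line (L 0) (L c)"
  have l: "is_line ?l" using c by (rule is_line_axis)
  obtain M where M: "is_nearest M (L a) ?l" using nearest_exists[OF l] by blast
  then have "M \<in> ?l" by (simp add: is_nearest_def)
  then obtain \<alpha> where \<alpha>: "M = L (\<alpha> *\<^sub>R c)" unfolding axis_iff by blast
  note inj = L_axis_inj[OF c]
  have dist: "len (L a, L ((\<alpha> + s) *\<^sub>R c)) = chart_norm (a - \<alpha> *\<^sub>R c - s *\<^sub>R c)" for s
    using len_L'[of a "(\<alpha> + s) *\<^sub>R c"] by (simp add: algebra_simps)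
  have "chart_norm (a - \<alpha> *\<^sub>R c + t *\<^sub>R c) = chart_norm (a - \<alpha> *\<^sub>R c - t *\<^sub>R c)" for t
  proof (cases "t = 0")
    case False
    define r where "r = len (L a, L ((\<alpha> + t) *\<^sub>R c))"
    let ?X = "L ((\<alpha> + t) *\<^sub>R c)"
    have XM: "?X \<noteq> M" using False by (simp add: \<alpha> inj)
    have Xl: "?X \<in> ?l" unfolding axis_iff by blast
    have "len (L a, M) < r"
      using M XM Xl unfolding is_nearest_def r_def by blast
    then have r: "r > 0" using chart_norm_nonneg[of "\<alpha> *\<^sub>R c - a"] len_L[of a "\<alpha> *\<^sub>R c"] by (simp add: \<alpha>)
    have X: "?X \<in> ?l \<inter> circle (L a) r" using Xl by (simp add: circle_def r_def)
    have "?l \<inter> circle (L a) r \<noteq> {?X}"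
      using A12[OF l r] nearest_unique[OF M] XM by metis
    then obtain Y where Y: "Y \<in> ?l \<inter> circle (L a) r" "Y \<noteq> ?X" using X by blast
    then obtain s' where "Y = L (s' *\<^sub>R c)" using axis_iff by blast
    then obtain s where s: "Y = L ((\<alpha> + s) *\<^sub>R c)" by (metis add.commute diff_add_cancel)
    have "is_midpoint (L ((\<alpha> + (t + s) / 2) *\<^sub>R c)) ?X Y"
      unfolding is_midpoint_def s by (rule L_sim) (simp add: algebra_simps flip: scaleR_add_left)
    then have "is_nearest (L ((\<alpha> + (t + s) / 2) *\<^sub>R c)) (L a) ?l"
      using A11[OF l r _ X Y(1)] Y(2) by metis
    then have "L ((\<alpha> + (t + s) / 2) *\<^sub>R c) = L (\<alpha> *\<^sub>R c)"
      using nearest_unique M unfolding \<alpha> by blast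
    then have "s = - t" unfolding inj by simp
    moreover have "len (L a, Y) = r" using Y(1) by (simp add: circle_def)
    ultimately show ?thesis using dist[of t] dist[of "- t"] by (simp add: s r_def)
  qed simp
  then show ?thesis by blast
qed

lemma scalar_proj_feet:
  assumes c: "chart_norm c \<noteq> 0"
    and \<alpha>: "chart_norm (a - \<alpha> *\<^sub>R c + c) = chart_norm (a - \<alpha> *\<^sub>R c - c)"
    and \<beta>: "chart_norm (b - \<beta> *\<^sub>R c + c) = chart_norm (b - \<beta> *\<^sub>R c - c)"
  shows "scalar_proj (L a, L b) (L 0, L c) = (\<beta> - \<alpha>) * chart_norm c"
proof -
  have proj: "orth_proj (L a) (line (L 0) (L c)) = L (\<alpha> *\<^sub>R c)"
    "orth_proj (L b) (line (L 0) (L c)) = L (\<beta> *\<^sub>R c)"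
    by (rule orth_proj_eq[OF nearest_if_orth[OF c]], fact)+
  have "(L (\<alpha> *\<^sub>R c), L (\<beta> *\<^sub>R c)) \<sim> t \<odot> (L 0, L c) \<longleftrightarrow> t = \<beta> - \<alpha>" for t
  proof
    have e: "(L (\<alpha> *\<^sub>R c), L (\<beta> *\<^sub>R c)) \<sim> (L 0, L ((\<beta> - \<alpha>) *\<^sub>R c))"
      by (rule L_sim) (simp add: algebra_simps)
    show "(L (\<alpha> *\<^sub>R c), L (\<beta> *\<^sub>R c)) \<sim> t \<odot> (L 0, L c)" if "t = \<beta> - \<alpha>"
      using e that by (simp add: L_smult)
    assume "(L (\<alpha> *\<^sub>R c), L (\<beta> *\<^sub>R c)) \<sim> t \<odot> (L 0, L c)"
    then have "(L 0, L ((\<beta> - \<alpha>) *\<^sub>R c)) \<sim> (L 0, L (t *\<^sub>R c))"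
      using sim_trans[OF sim_sym[OF e]] by (simp add: L_smult)
    then have "L ((\<beta> - \<alpha>) *\<^sub>R c) = L (t *\<^sub>R c)" by (rule A2)
    then show "t = \<beta> - \<alpha>" by (simp only: L_axis_inj[OF c])
  qed
  moreover have "L 0 \<noteq> L c" using c A9_1 by metis
  ultimately show ?thesis by (simp add: scalar_proj_def proj)
qed

lemma chart_foot_symmetric:
  assumes "chart_norm a = chart_norm c" "chart_norm c \<noteq> 0"
    and "chart_norm (a - \<alpha> *\<^sub>R c + c) = chart_norm (a - \<alpha> *\<^sub>R c - c)"
    and "chart_norm (c - \<beta> *\<^sub>R a + a) = chart_norm (c - \<beta> *\<^sub>R a - a)"
  shows "\<alpha> = \<beta>"
  using scalar_proj_feet[of c 0 0 a \<alpha>] scalar_proj_feet[of a 0 0 c \<beta>] assms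
    A13[OF assms(1)] by (simp add: chart_norm_minus)

end

sublocale arrow_chart \<subseteq> foot_seminorm "\<lambda>v. len (L 0, L v)"
  using chart_norm_scale chart_norm_nonneg chart_norm_null chart_foot_exists
    chart_foot_unique chart_foot_symmetric
  by unfold_locales blast+

section \<open>The scalar product as a polarization\<close>

text \<open>The projection coefficients of the two end points of the first arrow are subtracted, and it takes
the additivity of the polarization to recognize the result as the coefficient of the difference
vector.\<close>

lemma (in arrow_chart) arrow_prod_polar: "arrow_prod (L a, L b) (L 0, L c) = polar (b - a) c"
proof (cases "len (L 0, L c) = 0")
  case True
  then show ?thesis
    using N_null[of c "b - a"] N_null_diff[of c "b - a"] by (simp add: arrow_prod_def polar_def)
next
  case False
  obtain \<alpha> h where \<alpha>: "a = h + \<alpha> *\<^sub>R c" "orth h c" by (rule orth_decomposition)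
  obtain \<beta> k where \<beta>: "b = k + \<beta> *\<^sub>R c" "orth k c" by (rule orth_decomposition)
  have o: "orth (a - \<alpha> *\<^sub>R c) c" "orth (b - \<beta> *\<^sub>R c) c" using \<alpha> \<beta> by simp_all
  show ?thesis
    unfolding arrow_prod_def scalar_proj_feet[OF False o[unfolded orth_def]]
      polar_diff polar_foot[OF o(1)] polar_foot[OF o(2)]
    by (simp add: power2_eq_square algebra_simps)
qed

context arrow_space
begin

text \<open>The right-hand side contains only lengths of arrows whose classes are determined by the classes of
the two factors. Hence the product of arrows depends on these classes alone.\<close>

lemma arrow_prod_len:
  assumes X: "(B, X) \<sim> (C, D)" and Y: "(B, Y) \<sim> (D, C)"
  shows "arrow_prod (A, B) (C, D) = ((len (A, X))\<^sup>2 - (len (A, Y))\<^sup>2) / 4"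
proof -
  obtain L :: "((real \<times> real) \<times> real) \<times> real \<Rightarrow> 'a" and a b c
    where L: "chart L" and p: "L 0 = C" "L a = A" "L b = B" "L c = D"
    using chart_exists by metis
  interpret arrow_chart sim smult len L by unfold_locales (rule L)
  have "(B, L (b + c)) \<sim> (C, D)" "(B, L (b - c)) \<sim> (D, C)"
    unfolding p[symmetric] by (rule L_sim; simp)+
  then have "X = L (b + c)" "Y = L (b - c)"
    using X Y A2 sim_sym sim_trans by blast+
  then have "len (A, X) = len (L 0, L (b - a + c))" "len (A, Y) = len (L 0, L (b - a - c))"
    using len_L[of a "b + c"] len_L[of a "b - c"] by (simp_all add: p algebra_simps)
  then show ?thesis using arrow_prod_polar[of a b c, unfolded polar_def] by (simp add: p)
qed

lemma arrow_prod_cong: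
  assumes a: "a \<sim> a'" and c: "c \<sim> c'" shows "arrow_prod a c = arrow_prod a' c'"
proof -
  obtain A B A' B' C D C' D' where e: "a = (A, B)" "a' = (A', B')" "c = (C, D)" "c' = (C', D')"
    by (cases a; cases a'; cases c; cases c')
  obtain X Y X' Y' where XY: "(B, X) \<sim> (C, D)" "(B, Y) \<sim> (D, C)" "(B', X') \<sim> (C', D')" "(B', Y') \<sim> (D', C')"
    using fourth_vertex by metis
  have "(B, X) \<sim> (B', X')" "(B, Y) \<sim> (B', Y')"
    using XY c A3_1 sim_sym sim_trans unfolding e by metis+
  then have "(A, X) \<sim> (A', X')" "(A, Y) \<sim> (A', Y')" using a A3_2 unfolding e by blast+
  then have "len (A, X) = len (A', X')" "len (A, Y) = len (A', Y')" using A8 by blast+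
  then show ?thesis
    unfolding e by (simp add: arrow_prod_len[OF XY(1,2)] arrow_prod_len[OF XY(3,4)])
qed

lemma vec_eq_iff: "vec a = vec b \<longleftrightarrow> a \<sim> b"
  unfolding vec_def using sim_refl sim_sym sim_trans by blast

lemma scalar_prod_vec: "scalar_prod (vec a) (vec c) = arrow_prod a c"
  unfolding scalar_prod_def vec_eq_iff
proof (rule the_equality)
  show "\<exists>a' c'. a \<sim> a' \<and> c \<sim> c' \<and> arrow_prod a c = arrow_prod a' c'"
    using sim_refl by blast
next
  fix r assume "\<exists>a' c'. a \<sim> a' \<and> c \<sim> c' \<and> r = arrow_prod a' c'"
  then show "r = arrow_prod a c" using arrow_prod_cong by metis
qed

lemma vec_smult_vec: "vec_smult t (vec a) = vec (t \<odot> a)"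
  unfolding vec_smult_def
proof (rule the_equality)
  fix w assume "\<exists>b. vec a = vec b \<and> w = vec (t \<odot> b)"
  then obtain b where "a \<sim> b" "w = vec (t \<odot> b)" by (auto simp: vec_eq_iff)
  then show "w = vec (t \<odot> a)" using A5 sim_sym by (metis surj_pair vec_eq_iff)
qed blast

lemma vec_add_vec: "vec_add (vec (A, B)) (vec (B, C)) = vec (A, C)"
  unfolding vec_add_def
proof (rule the_equality)
  fix w assume "\<exists>A' B' C'. vec (A, B) = vec (A', B') \<and> vec (B, C) = vec (B', C') \<and> w = vec (A', C')"
  then obtain A' B' C' where "(A, B) \<sim> (A', B')" "(B, C) \<sim> (B', C')" "w = vec (A', C')"
    unfolding vec_eq_iff by blast
  then show "w = vec (A, C)" using A3_2[of A B A' B' C C'] by (simp add: vec_eq_iff sim_sym)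
qed blast

lemma zero_vec_eq: "zero_vec = vec (A, A)"
  unfolding zero_vec_def using degenerate_sim vec_eq_iff by (intro the_equality) blast+

lemma vectors_from_point:
  assumes "a \<in> vectors" shows "\<exists>A. a = vec (Q, A)"
proof -
  obtain C D where "a = vec (C, D)" using assms by (auto simp: vectors_def)
  then show ?thesis using fourth_vertex[of Q C D] by (metis vec_eq_iff)
qed

lemma scalar_prod_properties:
  assumes "a \<in> vectors" "b \<in> vectors" "c \<in> vectors"
  shows "a \<noteq> zero_vec \<Longrightarrow> scalar_prod a a > 0"
    and "scalar_prod (vec_add a b) c = scalar_prod a c + scalar_prod b c"
    and "scalar_prod (vec_smult t a) b = t * scalar_prod a b"
    and "scalar_prod a b = scalar_prod b a"
proof -
  \<comment> \<open>Any point serves as the common initial point of the representing arrows.\<close>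
  obtain A B C where abc: "a = vec (undefined, A)" "b = vec (undefined, B)" "c = vec (undefined, C)"
    using assms vectors_from_point by metis
  obtain L :: "((real \<times> real) \<times> real) \<times> real \<Rightarrow> 'a" and u v w
    where L: "chart L" and "L 0 = undefined" "L u = A" "L v = B" "L w = C"
    using chart_exists by metis
  then have e: "a = vec (L 0, L u)" "b = vec (L 0, L v)" "c = vec (L 0, L w)"
    using abc by simp_all
  interpret arrow_chart sim smult len L by unfold_locales (rule L)
  have prod: "scalar_prod (vec (L 0, L x)) (vec (L 0, L y)) = polar x y" for x y
    by (simp add: scalar_prod_vec arrow_prod_polar)
  have "vec (L 0, L v) = vec (L u, L (u + v))"
    unfolding vec_eq_iff by (rule L_sim) simp
  then have "vec_add a b = vec (L 0, L (u + v))"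
    using vec_add_vec by (simp add: e)
  then show "scalar_prod (vec_add a b) c = scalar_prod a c + scalar_prod b c"
    by (simp add: e prod polar_add)
  show "scalar_prod (vec_smult t a) b = t * scalar_prod a b"
    by (simp add: e vec_smult_vec L_smult prod polar_scale)
  show "scalar_prod a b = scalar_prod b a"
    by (simp add: e prod polar_commute)
  show "scalar_prod a a > 0" if "a \<noteq> zero_vec"
  proof -
    have "L u \<noteq> L 0" using that zero_vec_eq e(1) by metis
    then have "len (L 0, L u) > 0" by (rule A9_2)
    then show ?thesis by (simp add: e prod polar_self)
  qed
qed

end

theorem theoremW5:
  fixes sim :: "'p arrow \<Rightarrow> 'p arrow \<Rightarrow> bool"
    and smult :: "real \<Rightarrow> 'p arrow \<Rightarrow> 'p arrow"
    and len :: "'p arrow \<Rightarrow> real"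
    and a b c :: "'p arrow set"
    and t :: real
  assumes "arrow_space sim smult len"
    and "a \<in> arrow_structure.vectors sim"
    and "b \<in> arrow_structure.vectors sim"
    and "c \<in> arrow_structure.vectors sim"
  shows "(a \<noteq> arrow_structure.zero_vec sim \<longrightarrow>
           arrow_structure.scalar_prod sim smult len a a > 0)
    \<and> arrow_structure.scalar_prod sim smult len (arrow_structure.vec_add sim a b) c
        = arrow_structure.scalar_prod sim smult len a c
          + arrow_structure.scalar_prod sim smult len b c
    \<and> arrow_structure.scalar_prod sim smult len (arrow_structure.vec_smult sim smult t a) b
        = t * arrow_structure.scalar_prod sim smult len a b
    \<and> arrow_structure.scalar_prod sim smult len a b
        = arrow_structure.scalar_prod sim smult len b a"
  using arrow_space.scalar_prod_properties[OF assms] by blast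

end
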